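(* Let $\mathcal{L}$ be a complete lattice, let $\mathcal{Q}$ be a poset with a superlinear family of translations $T_\bullet$, and let $\mathbf{C}$ be a category with all small limits and colimits. (1) If $f\colon\mathcal{L}\to\mathcal{Q}$ is a $\delta$-approximation that respects joins, then for every $\mathcal{Q}$-module $M\in\mathrm{Fun}(\mathcal{Q},\mathbf{C})$, $$d_{\mathcal{Q}}(M,f_*f^*M)=d_{\mathcal{Q}}(M,(f\circ f_\flat)^*M)\le\delta.$$ (2) If $f\colon\mathcal{L}\to\mathcal{Q}$ is a $\delta$-approximation that respects meets, then for every $\mathcal{Q}$-module $M\in\mathrm{Fun}(\mathcal{Q},\mathbf{C})$, $$d_{\mathcal{Q}}(M,f_\dagger f^*M)=d_{\mathcal{Q}}(M,(f\circ f_\sharp)^*M)\le\delta.$$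
   Context: Posets are viewed as categories; a map of posets is a monotone map. For a poset $\mathcal{P}$ and a category $\mathbf{C}$, a $\mathcal{P}$-module is a functor $\mathcal{P}\to\mathbf{C}$. For a map of posets $f\colon\mathcal{P}\to\mathcal{Q}$: $f^*M=M\circ f$ (pullback); $f_*M=\mathrm{Lan}_fM$, i.e. $(f_*M)(q)=\varinjlim_{p\,:\,f(p)\le q}M(p)$ (pushforward); $f_\dagger M=\mathrm{Ran}_fM$, i.e. $(f_\dagger M)(q)=\varprojlim_{p\,:\,f(p)\ge q}M(p)$ (pushforward with open supports). $f_*f^*M$ and $f_\dagger f^*M$ are the lower and upper pixelizations of $M$. For $f\colon\mathcal{L}\to\mathcal{Q}$ with $\mathcal{L}$ a complete lattice, $f_\flat,f_\sharp\colon\mathcal{Q}\to\mathcal{L}$ are $f_\flat(q)=\sup\{x\mid f(x)\le q\}$ and $f_\sharp(q)=\inf\{x\mid f(x)\ge q\}$. $f$ respects joins if for all $S\subseteq\mathcal{L}$ (possibly empty) and $q\in\mathcal{Q}$ with $f(x)\le q$ for all $x\in S$, one has $f(\bigvee S)\le q$; $f$ respects meets if for all $S\subseteq\mathcal{L}$ and $q$ with $f(x)\ge q$ for all $x\in S$, one has $f(\bigwedge S)\ge q$. A translation on $\mathcal{Q}$ is a monotone map $T\colon\mathcal{Q}\to\mathcal{Q}$ with $q\le T(q)$ for all $q$. A superlinear family of translations is an assignment $\varepsilon\mapsto T_\varepsilon$, $\varepsilon\in[0,\infty)$, of translations with $T_{\varepsilon_2}\circ T_{\varepsilon_1}\le T_{\varepsilon_1+\varepsilon_2}$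 pointwise (hence $T_\varepsilon\le T_{\varepsilon'}$ when $\varepsilon\le\varepsilon'$). $f$ is a $\delta$-approximation if for every $q\in\mathcal{Q}$ there is $x\in\mathcal{L}$ with $q\le f(x)\le T_\delta(q)$. Weak interleavings over $\mathcal{Q}$: $(M)^\varepsilon_{\mathcal{Q}}=M\circ T_\varepsilon$ (with $\varphi^\varepsilon=T_\varepsilon^*\varphi$). The internal maps of $M$ give natural maps $\eta^\varepsilon\colon M\to(M)^\varepsilon_{\mathcal{Q}}$, $\eta^{\varepsilon,\varepsilon'}\colon(M)^\varepsilon_{\mathcal{Q}}\to(M)^{\varepsilon'}_{\mathcal{Q}}$ for $\varepsilon\le\varepsilon'$, and $\Sigma^{\varepsilon_1,\varepsilon_2}\colon((M)^{\varepsilon_1}_{\mathcal{Q}})^{\varepsilon_2}_{\mathcal{Q}}\to(M)^{\varepsilon_1+\varepsilon_2}_{\mathcal{Q}}$. A weak $\varepsilon$-interleaving of $M,N$ is a pair $\varphi\colon M\to(N)^\varepsilon_{\mathcal{Q}}$, $\psi\colon N\to(M)^\varepsilon_{\mathcal{Q}}$ with $\Sigma^{\varepsilon,\varepsilon}\circ\psi^\varepsilon\circ\varphi=\eta^{0,2\varepsilon}\circ\eta^0$ on $M$ and symmetrically on $N$. The weak interleaving distance $d_{\mathcal{Q}}(M,N)$ is the infimum of $\varepsilon\ge0$ for which one exists ($\infty$ if none). *)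

theory Defs
  imports Complex_Main "HOL-Library.Extended_Real"
begin

section \<open>Categories, functors, natural transformations\<close>

text \<open>A category has a carrier set of objects and a carrier set of arrows; nothing is required of
  the structure maps outside the carriers. \<open>Comp C g f\<close> is the composite ``\<open>g\<close> after \<open>f\<close>''.\<close>

record ('o, 'a) cat =
  Obj :: "'o set"
  Arr :: "'a set"
  Dom :: "'a \<Rightarrow> 'o"
  Cod :: "'a \<Rightarrow> 'o"
  Id :: "'o \<Rightarrow> 'a"
  Comp :: "'a \<Rightarrow> 'a \<Rightarrow> 'a"

definition hom_set :: "('o, 'a) cat \<Rightarrow> 'o \<Rightarrow> 'o \<Rightarrow> 'a set" where
  "hom_set C x y = {f \<in> Arr C. Dom C f = x \<and> Cod C f = y}"

locale category =
  fixes C :: "('o, 'a) cat"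
  assumes dom_obj: "f \<in> Arr C \<Longrightarrow> Dom C f \<in> Obj C"
    and cod_obj: "f \<in> Arr C \<Longrightarrow> Cod C f \<in> Obj C"
    and id_hom: "x \<in> Obj C \<Longrightarrow> Id C x \<in> hom_set C x x"
    and comp_hom: "f \<in> hom_set C x y \<Longrightarrow> g \<in> hom_set C y z \<Longrightarrow> Comp C g f \<in> hom_set C x z"
    and comp_id_right: "f \<in> hom_set C x y \<Longrightarrow> Comp C f (Id C x) = f"
    and comp_id_left: "f \<in> hom_set C x y \<Longrightarrow> Comp C (Id C y) f = f"
    and comp_assoc: "f \<in> hom_set C w x \<Longrightarrow> g \<in> hom_set C x y \<Longrightarrow> h \<in> hom_set C y z \<Longrightarrow>
      Comp C h (Comp C g f) = Comp C (Comp C h g) f"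

record ('i, 'k, 'o, 'a) func =
  FObj :: "'i \<Rightarrow> 'o"
  FArr :: "'k \<Rightarrow> 'a"

definition is_functor :: "('i, 'k) cat \<Rightarrow> ('o, 'a) cat \<Rightarrow> ('i, 'k, 'o, 'a) func \<Rightarrow> bool" where
  "is_functor J C F \<longleftrightarrow>
    (\<forall>x \<in> Obj J. FObj F x \<in> Obj C) \<and>
    (\<forall>x \<in> Obj J. \<forall>y \<in> Obj J. \<forall>u \<in> hom_set J x y. FArr F u \<in> hom_set C (FObj F x) (FObj F y)) \<and>
    (\<forall>x \<in> Obj J. FArr F (Id J x) = Id C (FObj F x)) \<and>
    (\<forall>x \<in> Obj J. \<forall>y \<in> Obj J. \<forall>z \<in> Obj J. \<forall>u \<in> hom_set J x y. \<forall>v \<in> hom_set J y z.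
      FArr F (Comp J v u) = Comp C (FArr F v) (FArr F u))"

definition nat_trans ::
  "('i, 'k) cat \<Rightarrow> ('o, 'a) cat \<Rightarrow> ('i, 'k, 'o, 'a) func \<Rightarrow> ('i, 'k, 'o, 'a) func \<Rightarrow> ('i \<Rightarrow> 'a) \<Rightarrow> bool"
where
  "nat_trans J C F G \<tau> \<longleftrightarrow>
    (\<forall>x \<in> Obj J. \<tau> x \<in> hom_set C (FObj F x) (FObj G x)) \<and>
    (\<forall>x \<in> Obj J. \<forall>y \<in> Obj J. \<forall>u \<in> hom_set J x y.
      Comp C (\<tau> y) (FArr F u) = Comp C (FArr G u) (\<tau> x))"

definition vcomp :: "('o, 'a) cat \<Rightarrow> ('i \<Rightarrow> 'a) \<Rightarrow> ('i \<Rightarrow> 'a) \<Rightarrow> ('i \<Rightarrow> 'a)" where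
  "vcomp C \<tau> \<sigma> = (\<lambda>x. Comp C (\<tau> x) (\<sigma> x))"


section \<open>Limits and colimits\<close>

definition is_cone ::
  "('i, 'k) cat \<Rightarrow> ('o, 'a) cat \<Rightarrow> ('i, 'k, 'o, 'a) func \<Rightarrow> 'o \<Rightarrow> ('i \<Rightarrow> 'a) \<Rightarrow> bool" where
  "is_cone J C D c \<pi> \<longleftrightarrow> c \<in> Obj C \<and>
    (\<forall>x \<in> Obj J. \<pi> x \<in> hom_set C c (FObj D x)) \<and>
    (\<forall>x \<in> Obj J. \<forall>y \<in> Obj J. \<forall>u \<in> hom_set J x y. Comp C (FArr D u) (\<pi> x) = \<pi> y)"

definition is_limit ::
  "('i, 'k) cat \<Rightarrow> ('o, 'a) cat \<Rightarrow> ('i, 'k, 'o, 'a) func \<Rightarrow> 'o \<Rightarrow> ('i \<Rightarrow> 'a) \<Rightarrow> bool" where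
  "is_limit J C D c \<pi> \<longleftrightarrow> is_cone J C D c \<pi> \<and>
    (\<forall>c' \<pi>'. is_cone J C D c' \<pi>' \<longrightarrow>
      (\<exists>!h. h \<in> hom_set C c' c \<and> (\<forall>x \<in> Obj J. Comp C (\<pi> x) h = \<pi>' x)))"

definition is_cocone ::
  "('i, 'k) cat \<Rightarrow> ('o, 'a) cat \<Rightarrow> ('i, 'k, 'o, 'a) func \<Rightarrow> 'o \<Rightarrow> ('i \<Rightarrow> 'a) \<Rightarrow> bool" where
  "is_cocone J C D c \<iota> \<longleftrightarrow> c \<in> Obj C \<and>
    (\<forall>x \<in> Obj J. \<iota> x \<in> hom_set C (FObj D x) c) \<and>
    (\<forall>x \<in> Obj J. \<forall>y \<in> Obj J. \<forall>u \<in> hom_set J x y. Comp C (\<iota> y) (FArr D u) = \<iota> x)"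

definition is_colimit ::
  "('i, 'k) cat \<Rightarrow> ('o, 'a) cat \<Rightarrow> ('i, 'k, 'o, 'a) func \<Rightarrow> 'o \<Rightarrow> ('i \<Rightarrow> 'a) \<Rightarrow> bool" where
  "is_colimit J C D c \<iota> \<longleftrightarrow> is_cocone J C D c \<iota> \<and>
    (\<forall>c' \<iota>'. is_cocone J C D c' \<iota>' \<longrightarrow>
      (\<exists>!h. h \<in> hom_set C c c' \<and> (\<forall>x \<in> Obj J. Comp C h (\<iota> x) = \<iota>' x)))"

text \<open>HOL has no built-in notion of smallness. A type \<open>'u\<close> plays the role of the universe: a small
  category is one whose objects and arrows are elements of \<open>'u\<close>. Every category whose sets of
  objects and arrows inject into \<open>'u\<close> is isomorphic to one of these; if \<open>'u\<close> is infinite, this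
  covers every poset, viewed as a category, whose underlying set injects into \<open>'u\<close>.\<close>

definition has_small_limits :: "'u itself \<Rightarrow> ('o, 'a) cat \<Rightarrow> bool" where
  "has_small_limits U C \<longleftrightarrow>
    (\<forall>(J :: ('u, 'u) cat) D. category J \<longrightarrow> is_functor J C D \<longrightarrow> (\<exists>c \<pi>. is_limit J C D c \<pi>))"

definition has_small_colimits :: "'u itself \<Rightarrow> ('o, 'a) cat \<Rightarrow> bool" where
  "has_small_colimits U C \<longleftrightarrow>
    (\<forall>(J :: ('u, 'u) cat) D. category J \<longrightarrow> is_functor J C D \<longrightarrow> (\<exists>c \<iota>. is_colimit J C D c \<iota>))"

text \<open>An arbitrary choice of limiting cone and of colimiting cocone (meaningful if one exists).\<close>

definition limit_cone ::
  "('i, 'k) cat \<Rightarrow> ('o, 'a) cat \<Rightarrow> ('i, 'k, 'o, 'a) func \<Rightarrow> 'o \<times> ('i \<Rightarrow> 'a)" where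
  "limit_cone J C D = (SOME (c, \<pi>). is_limit J C D c \<pi>)"

definition colimit_cocone ::
  "('i, 'k) cat \<Rightarrow> ('o, 'a) cat \<Rightarrow> ('i, 'k, 'o, 'a) func \<Rightarrow> 'o \<times> ('i \<Rightarrow> 'a)" where
  "colimit_cocone J C D = (SOME (c, \<iota>). is_colimit J C D c \<iota>)"


section \<open>Modules over posets\<close>

text \<open>The full subposet \<open>S\<close> of the poset \<open>'p\<close> as a category; \<open>(x, y)\<close> is the unique arrow from \<open>x\<close>
  to \<open>y\<close> when \<open>x \<le> y\<close>.\<close>

definition poset_cat :: "'p::order set \<Rightarrow> ('p, 'p \<times> 'p) cat" where
  "poset_cat S = \<lparr>Obj = S, Arr = {(x, y). x \<in> S \<and> y \<in> S \<and> x \<le> y}, Dom = fst, Cod = snd,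
    Id = (\<lambda>x. (x, x)), Comp = (\<lambda>v u. (fst u, snd v))\<rparr>"

lemma category_poset_cat: "category (poset_cat S)"
  by unfold_locales (auto simp: poset_cat_def hom_set_def)

type_synonym ('p, 'o, 'a) pmodule = "('p, 'p \<times> 'p, 'o, 'a) func"

definition is_module :: "('o, 'a) cat \<Rightarrow> ('p::order, 'o, 'a) pmodule \<Rightarrow> bool" where
  "is_module C M \<longleftrightarrow> is_functor (poset_cat UNIV) C M"

definition pullback :: "('p \<Rightarrow> 'q) \<Rightarrow> ('q, 'o, 'a) pmodule \<Rightarrow> ('p, 'o, 'a) pmodule" where
  "pullback f M = \<lparr>FObj = (\<lambda>p. FObj M (f p)), FArr = (\<lambda>(x, y). FArr M (f x, f y))\<rparr>"

text \<open>Pushforward: \<open>(f\<^sub>* M) q\<close> is the colimit of \<open>M\<close> over the subposet \<open>{p. f p \<le> q}\<close>, and for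
  \<open>q \<le> r\<close> the internal map is the one induced by \<open>{p. f p \<le> q} \<subseteq> {p. f p \<le> r}\<close>. No restriction of
  \<open>M\<close> to the subposet is needed, since \<open>is_colimit\<close> only inspects the diagram on its index category.\<close>

definition pushforward ::
  "('o, 'a) cat \<Rightarrow> ('p::order \<Rightarrow> 'q::order) \<Rightarrow> ('p, 'o, 'a) pmodule \<Rightarrow> ('q, 'o, 'a) pmodule" where
  "pushforward C f M =
    (let K = (\<lambda>q. colimit_cocone (poset_cat {p. f p \<le> q}) C M) in
      \<lparr>FObj = (\<lambda>q. fst (K q)),
       FArr = (\<lambda>(q, r). THE h. h \<in> hom_set C (fst (K q)) (fst (K r)) \<and>
         (\<forall>p. f p \<le> q \<longrightarrow> Comp C h (snd (K q) p) = snd (K r) p))\<rparr>)"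

text \<open>Pushforward with open supports: dually, \<open>q\<close> is sent to the limit over \<open>{p. q \<le> f p}\<close>, and for
  \<open>q \<le> r\<close> the internal map is induced by \<open>{p. r \<le> f p} \<subseteq> {p. q \<le> f p}\<close>.\<close>

definition pushforward_open ::
  "('o, 'a) cat \<Rightarrow> ('p::order \<Rightarrow> 'q::order) \<Rightarrow> ('p, 'o, 'a) pmodule \<Rightarrow> ('q, 'o, 'a) pmodule" where
  "pushforward_open C f M =
    (let K = (\<lambda>q. limit_cone (poset_cat {p. q \<le> f p}) C M) in
      \<lparr>FObj = (\<lambda>q. fst (K q)),
       FArr = (\<lambda>(q, r). THE h. h \<in> hom_set C (fst (K q)) (fst (K r)) \<and>
         (\<forall>p. r \<le> f p \<longrightarrow> Comp C (snd (K r) p) h = snd (K q) p))\<rparr>)"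


section \<open>Maps out of complete lattices\<close>

definition flat :: "('l::complete_lattice \<Rightarrow> 'q::order) \<Rightarrow> 'q \<Rightarrow> 'l" where
  "flat f q = Sup {x. f x \<le> q}"

definition sharp :: "('l::complete_lattice \<Rightarrow> 'q::order) \<Rightarrow> 'q \<Rightarrow> 'l" where
  "sharp f q = Inf {x. q \<le> f x}"

definition respects_joins :: "('l::complete_lattice \<Rightarrow> 'q::order) \<Rightarrow> bool" where
  "respects_joins f \<longleftrightarrow> (\<forall>S q. (\<forall>x \<in> S. f x \<le> q) \<longrightarrow> f (Sup S) \<le> q)"

definition respects_meets :: "('l::complete_lattice \<Rightarrow> 'q::order) \<Rightarrow> bool" where
  "respects_meets f \<longleftrightarrow> (\<forall>S q. (\<forall>x \<in> S. q \<le> f x) \<longrightarrow> q \<le> f (Inf S))"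


section \<open>Translations and weak interleavings\<close>

definition translation :: "('q::order \<Rightarrow> 'q) \<Rightarrow> bool" where
  "translation t \<longleftrightarrow> mono t \<and> (\<forall>q. q \<le> t q)"

text \<open>Families indexed by \<open>[0, \<infinity>)\<close> are functions on the reals that are only used at nonnegative
  arguments.\<close>

definition superlinear_family :: "(real \<Rightarrow> 'q::order \<Rightarrow> 'q) \<Rightarrow> bool" where
  "superlinear_family T \<longleftrightarrow>
    (\<forall>\<epsilon>\<ge>0. translation (T \<epsilon>)) \<and>
    (\<forall>\<epsilon>\<^sub>1\<ge>0. \<forall>\<epsilon>\<^sub>2\<ge>0. \<forall>q. T \<epsilon>\<^sub>2 (T \<epsilon>\<^sub>1 q) \<le> T (\<epsilon>\<^sub>1 + \<epsilon>\<^sub>2) q)"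

definition is_approximation :: "(real \<Rightarrow> 'q::order \<Rightarrow> 'q) \<Rightarrow> real \<Rightarrow> ('l \<Rightarrow> 'q) \<Rightarrow> bool" where
  "is_approximation T \<delta> f \<longleftrightarrow> (\<forall>q. \<exists>x. q \<le> f x \<and> f x \<le> T \<delta> q)"

definition shift ::
  "(real \<Rightarrow> 'q \<Rightarrow> 'q) \<Rightarrow> real \<Rightarrow> ('q, 'o, 'a) pmodule \<Rightarrow> ('q, 'o, 'a) pmodule" where
  "shift T \<epsilon> M = pullback (T \<epsilon>) M"

definition shift_hom :: "(real \<Rightarrow> 'q \<Rightarrow> 'q) \<Rightarrow> real \<Rightarrow> ('q \<Rightarrow> 'a) \<Rightarrow> ('q \<Rightarrow> 'a)" where
  "shift_hom T \<epsilon> \<phi> = (\<lambda>q. \<phi> (T \<epsilon> q))"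

definition eta :: "(real \<Rightarrow> 'q \<Rightarrow> 'q) \<Rightarrow> ('q, 'o, 'a) pmodule \<Rightarrow> real \<Rightarrow> ('q \<Rightarrow> 'a)" where
  "eta T M \<epsilon> = (\<lambda>q. FArr M (q, T \<epsilon> q))"

definition eta2 :: "(real \<Rightarrow> 'q \<Rightarrow> 'q) \<Rightarrow> ('q, 'o, 'a) pmodule \<Rightarrow> real \<Rightarrow> real \<Rightarrow> ('q \<Rightarrow> 'a)" where
  "eta2 T M \<epsilon> \<epsilon>' = (\<lambda>q. FArr M (T \<epsilon> q, T \<epsilon>' q))"

text \<open>The double shift \<open>shift T \<epsilon>\<^sub>2 (shift T \<epsilon>\<^sub>1 M)\<close> is \<open>M \<circ> T \<epsilon>\<^sub>1 \<circ> T \<epsilon>\<^sub>2\<close>.\<close>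

definition Sigma_map ::
  "(real \<Rightarrow> 'q \<Rightarrow> 'q) \<Rightarrow> ('q, 'o, 'a) pmodule \<Rightarrow> real \<Rightarrow> real \<Rightarrow> ('q \<Rightarrow> 'a)" where
  "Sigma_map T M \<epsilon>\<^sub>1 \<epsilon>\<^sub>2 = (\<lambda>q. FArr M (T \<epsilon>\<^sub>1 (T \<epsilon>\<^sub>2 q), T (\<epsilon>\<^sub>1 + \<epsilon>\<^sub>2) q))"

definition weak_interleaving ::
  "('o, 'a) cat \<Rightarrow> (real \<Rightarrow> 'q::order \<Rightarrow> 'q) \<Rightarrow> real \<Rightarrow> ('q, 'o, 'a) pmodule \<Rightarrow> ('q, 'o, 'a) pmodule \<Rightarrow>
    ('q \<Rightarrow> 'a) \<Rightarrow> ('q \<Rightarrow> 'a) \<Rightarrow> bool" where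
  "weak_interleaving C T \<epsilon> M N \<phi> \<psi> \<longleftrightarrow>
    nat_trans (poset_cat UNIV) C M (shift T \<epsilon> N) \<phi> \<and>
    nat_trans (poset_cat UNIV) C N (shift T \<epsilon> M) \<psi> \<and>
    vcomp C (Sigma_map T M \<epsilon> \<epsilon>) (vcomp C (shift_hom T \<epsilon> \<psi>) \<phi>) =
      vcomp C (eta2 T M 0 (2 * \<epsilon>)) (eta T M 0) \<and>
    vcomp C (Sigma_map T N \<epsilon> \<epsilon>) (vcomp C (shift_hom T \<epsilon> \<phi>) \<psi>) =
      vcomp C (eta2 T N 0 (2 * \<epsilon>)) (eta T N 0)"

definition weak_dist ::
  "('o, 'a) cat \<Rightarrow> (real \<Rightarrow> 'q::order \<Rightarrow> 'q) \<Rightarrow> ('q, 'o, 'a) pmodule \<Rightarrow> ('q, 'o, 'a) pmodule \<Rightarrow> ereal"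
where
  "weak_dist C T M N = Inf {ereal \<epsilon> |\<epsilon>. 0 \<le> \<epsilon> \<and> (\<exists>\<phi> \<psi>. weak_interleaving C T \<epsilon> M N \<phi> \<psi>)}"

end

theory Submission
  imports Defs
begin

text \<open>
  A map \<open>f\<close> that respects joins has a right adjoint, namely \<open>flat f\<close>: one has \<open>f x \<le> q\<close> iff
  \<open>x \<le> flat f q\<close>. Hence the index poset \<open>{x. f x \<le> q}\<close> of the colimit that defines the pushforward
  at \<open>q\<close> has the greatest element \<open>flat f q\<close>, and a colimit over a poset with a greatest element is
  evaluation at that element. So the pushforward along \<open>f\<close> is naturally isomorphic to the pullback
  along \<open>flat f\<close> (\<open>pushforward_iso_pullback\<close>). Dually, a map that respects meets has the left
  adjoint \<open>sharp f\<close>, and its pushforward with open supports is the pullback along \<open>sharp f\<close>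
  (\<open>pushforward_open_iso_pullback\<close>). A natural isomorphism carries interleavings to interleavings,
  so the distances agree (\<open>weak_dist_iso\<close>).

  For the bound put \<open>g = f \<circ> flat f\<close> or \<open>g = f \<circ> sharp f\<close>. A \<open>\<delta>\<close>-approximation satisfies
  \<open>q \<le> g (T\<^sub>\<delta> q)\<close> and \<open>g q \<le> T\<^sub>\<delta> q\<close> in both cases, so internal maps of \<open>M\<close> provide the two halves of
  an interleaving of \<open>M\<close> with \<open>g\<^sup>* M\<close>. All the required identities hold because any two composites
  of internal maps with the same endpoints are equal (\<open>weak_dist_pullback_le\<close>).
\<close>

section \<open>Modules over a poset\<close>

lemma pullback_simps [simp]:
  "FObj (pullback f M) p = FObj M (f p)"
  "FArr (pullback f M) (x, y) = FArr M (f x, f y)"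
  by (simp_all add: pullback_def)

lemma pullback_pullback: "pullback g (pullback f M) = pullback (f \<circ> g) M"
  by (auto simp: pullback_def)

lemma hom_set_poset_cat:
  "u \<in> hom_set (poset_cat S) x y \<longleftrightarrow> u = (x, y) \<and> x \<in> S \<and> y \<in> S \<and> x \<le> y"
  by (auto simp: poset_cat_def hom_set_def)

lemma poset_cat_simps [simp]:
  "Obj (poset_cat S) = S" "Id (poset_cat S) x = (x, x)"
  "Comp (poset_cat S) (y, z) (x, y') = (x, z)"
  by (simp_all add: poset_cat_def)

lemma ball_hom_set_poset_cat:
  "(\<forall>u \<in> hom_set (poset_cat S) x y. P u) \<longleftrightarrow> (x \<in> S \<and> y \<in> S \<and> x \<le> y \<longrightarrow> P (x, y))"
  by (auto simp: hom_set_poset_cat)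

lemma is_module_iff:
  "is_module C M \<longleftrightarrow>
    (\<forall>x. FObj M x \<in> Obj C) \<and>
    (\<forall>x y. x \<le> y \<longrightarrow> FArr M (x, y) \<in> hom_set C (FObj M x) (FObj M y)) \<and>
    (\<forall>x. FArr M (x, x) = Id C (FObj M x)) \<and>
    (\<forall>x y z. x \<le> y \<longrightarrow> y \<le> z \<longrightarrow> Comp C (FArr M (y, z)) (FArr M (x, y)) = FArr M (x, z))"
  unfolding is_module_def is_functor_def
  by (simp only: ball_hom_set_poset_cat poset_cat_simps ball_UNIV UNIV_I simp_thms
      eq_commute[of "Comp C u v" for u v])

lemma module_obj: "is_module C M \<Longrightarrow> FObj M x \<in> Obj C"
  and module_hom: "is_module C M \<Longrightarrow> x \<le> y \<Longrightarrow> FArr M (x, y) \<in> hom_set C (FObj M x) (FObj M y)"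
  and module_id: "is_module C M \<Longrightarrow> FArr M (x, x) = Id C (FObj M x)"
  and module_comp: "is_module C M \<Longrightarrow> x \<le> y \<Longrightarrow> y \<le> z \<Longrightarrow>
    Comp C (FArr M (y, z)) (FArr M (x, y)) = FArr M (x, z)"
  by (simp_all add: is_module_iff)

lemma is_module_pullback: "is_module C M \<Longrightarrow> mono g \<Longrightarrow> is_module C (pullback g M)"
  by (simp add: is_module_iff mono_def)

lemma nat_trans_module_iff:
  "nat_trans (poset_cat UNIV) C M N \<tau> \<longleftrightarrow>
    (\<forall>x. \<tau> x \<in> hom_set C (FObj M x) (FObj N x)) \<and>
    (\<forall>x y. x \<le> y \<longrightarrow> Comp C (\<tau> y) (FArr M (x, y)) = Comp C (FArr N (x, y)) (\<tau> x))"
  by (auto simp: nat_trans_def hom_set_poset_cat)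

section \<open>Isomorphic modules have the same weak interleavings\<close>

text \<open>The last clause is naturality of \<open>\<alpha>\<close>, solved for the internal maps of \<open>N'\<close>. In this form it
  determines \<open>N'\<close> on arrows, so that functoriality of \<open>N'\<close> is a consequence.\<close>

definition module_iso ::
  "('o, 'a) cat \<Rightarrow> ('q::order, 'o, 'a) pmodule \<Rightarrow> ('q, 'o, 'a) pmodule \<Rightarrow> ('q \<Rightarrow> 'a) \<Rightarrow> ('q \<Rightarrow> 'a) \<Rightarrow> bool"
where
  "module_iso C N N' \<alpha> \<beta> \<longleftrightarrow>
    (\<forall>q. \<alpha> q \<in> hom_set C (FObj N q) (FObj N' q) \<and> \<beta> q \<in> hom_set C (FObj N' q) (FObj N q) \<and>
      Comp C (\<beta> q) (\<alpha> q) = Id C (FObj N q) \<and> Comp C (\<alpha> q) (\<beta> q) = Id C (FObj N' q)) \<and>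
    (\<forall>q r. q \<le> r \<longrightarrow> FArr N' (q, r) = Comp C (\<alpha> r) (Comp C (FArr N (q, r)) (\<beta> q)))"

context category
begin

lemma hom_set_obj: "f \<in> hom_set C x y \<Longrightarrow> x \<in> Obj C \<and> y \<in> Obj C"
  using dom_obj cod_obj by (auto simp: hom_set_def)

lemma comp_cancel:
  assumes "u \<in> hom_set C w x" "a \<in> hom_set C x y" "b \<in> hom_set C y x" "Comp C b a = Id C x"
  shows "Comp C b (Comp C a u) = u"
  using assms by (simp add: comp_assoc comp_id_left)

context
  fixes N N' :: "('q::order, 'o, 'a) pmodule" and \<alpha> \<beta> :: "'q \<Rightarrow> 'a"
  assumes iso: "module_iso C N N' \<alpha> \<beta>" and N: "is_module C N"
begin

lemma iso_hom: "\<alpha> q \<in> hom_set C (FObj N q) (FObj N' q)"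
  and iso_inv_hom: "\<beta> q \<in> hom_set C (FObj N' q) (FObj N q)"
  and iso_left: "Comp C (\<beta> q) (\<alpha> q) = Id C (FObj N q)"
  and iso_right: "Comp C (\<alpha> q) (\<beta> q) = Id C (FObj N' q)"
  and iso_arr: "q \<le> r \<Longrightarrow> FArr N' (q, r) = Comp C (\<alpha> r) (Comp C (FArr N (q, r)) (\<beta> q))"
  using iso by (simp_all add: module_iso_def)

lemma iso_arr_hom: "q \<le> r \<Longrightarrow> FArr N' (q, r) \<in> hom_set C (FObj N' q) (FObj N' r)"
  using comp_hom[OF comp_hom[OF iso_inv_hom module_hom[OF N]] iso_hom] by (simp add: iso_arr)

lemma iso_natural:
  assumes "q \<le> r"
  shows "Comp C (FArr N' (q, r)) (\<alpha> q) = Comp C (\<alpha> r) (FArr N (q, r))"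
proof -
  note u = module_hom[OF N assms]
  have "Comp C (FArr N' (q, r)) (\<alpha> q)
      = Comp C (\<alpha> r) (Comp C (Comp C (FArr N (q, r)) (\<beta> q)) (\<alpha> q))"
    using comp_assoc[OF iso_hom comp_hom[OF iso_inv_hom u] iso_hom] iso_arr[OF assms] by simp
  also have "Comp C (Comp C (FArr N (q, r)) (\<beta> q)) (\<alpha> q) = FArr N (q, r)"
    using comp_assoc[OF iso_hom iso_inv_hom u] comp_id_right[OF u] iso_left by simp
  finally show ?thesis .
qed

lemma iso_natural_inv:
  assumes "q \<le> r"
  shows "Comp C (FArr N (q, r)) (\<beta> q) = Comp C (\<beta> r) (FArr N' (q, r))"
  using comp_cancel[OF comp_hom[OF iso_inv_hom module_hom[OF N assms]] iso_hom iso_inv_hom iso_left]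
    iso_arr[OF assms] by simp

lemma module_iso_sym: "module_iso C N' N \<beta> \<alpha>"
proof -
  have "FArr N (q, r) = Comp C (\<beta> r) (Comp C (FArr N' (q, r)) (\<alpha> q))" if "q \<le> r" for q r
    using comp_cancel[OF module_hom[OF N that] iso_hom iso_inv_hom iso_left]
      iso_natural[OF that] by simp
  then show ?thesis
    using iso by (simp add: module_iso_def)
qed

lemma module_iso_is_module: "is_module C N'"
  unfolding is_module_iff
proof (intro conjI allI impI)
  fix x y z :: 'q
  show "FObj N' x \<in> Obj C"
    using hom_set_obj[OF iso_hom] by blast
  show "FArr N' (x, x) = Id C (FObj N' x)"
    using iso_arr[of x x] comp_id_left[OF iso_inv_hom] iso_right module_id[OF N] by simp
  show "FArr N' (x, y) \<in> hom_set C (FObj N' x) (FObj N' y)" if "x \<le> y"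
    by (rule iso_arr_hom[OF that])
  show "Comp C (FArr N' (y, z)) (FArr N' (x, y)) = FArr N' (x, z)" if xy: "x \<le> y" and yz: "y \<le> z"
  proof -
    note u = module_hom[OF N xy] and v = module_hom[OF N yz]
    have "Comp C (FArr N' (y, z)) (FArr N' (x, y))
        = Comp C (Comp C (FArr N' (y, z)) (\<alpha> y)) (Comp C (FArr N (x, y)) (\<beta> x))"
      using comp_assoc[OF comp_hom[OF iso_inv_hom u] iso_hom iso_arr_hom[OF yz]]
        iso_arr[OF xy] by simp
    also have "\<dots> = Comp C (\<alpha> z) (Comp C (FArr N (y, z)) (Comp C (FArr N (x, y)) (\<beta> x)))"
      using comp_assoc[OF comp_hom[OF iso_inv_hom u] v iso_hom] iso_natural[OF yz] by simp
    also have "\<dots> = Comp C (\<alpha> z) (Comp C (FArr N (x, z)) (\<beta> x))"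
      using comp_assoc[OF iso_inv_hom u v] module_comp[OF N xy yz] by simp
    finally show ?thesis
      using iso_arr xy yz by simp
  qed
qed

end

end

lemma superlinear_family_mono: "superlinear_family T \<Longrightarrow> 0 \<le> \<epsilon> \<Longrightarrow> x \<le> y \<Longrightarrow> T \<epsilon> x \<le> T \<epsilon> y"
  and superlinear_family_ge: "superlinear_family T \<Longrightarrow> 0 \<le> \<epsilon> \<Longrightarrow> x \<le> T \<epsilon> x"
  and superlinear_family_comp: "superlinear_family T \<Longrightarrow> 0 \<le> \<epsilon> \<Longrightarrow> T \<epsilon> (T \<epsilon> x) \<le> T (2 * \<epsilon>) x"
  unfolding superlinear_family_def translation_def mono_def mult_2 by blast+

lemma superlinear_family_zero_le:
  assumes T: "superlinear_family T" and "0 \<le> \<epsilon>"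
  shows "T 0 x \<le> T \<epsilon> x"
proof -
  have "T 0 x \<le> T \<epsilon> (T 0 x)"
    using assms by (rule superlinear_family_ge)
  also have "\<dots> \<le> T (0 + \<epsilon>) x"
    using assms unfolding superlinear_family_def by blast
  finally show ?thesis by simp
qed

text \<open>For modules, the composite of the two comparison maps on the right-hand side of the interleaving
  identities is a single internal map, although \<open>T 0\<close> need not be the identity.\<close>

lemma weak_interleaving_iff:
  assumes M: "is_module C M" and N: "is_module C N"
    and T: "superlinear_family T" and \<epsilon>: "0 \<le> \<epsilon>"
  shows "weak_interleaving C T \<epsilon> M N \<phi> \<psi> \<longleftrightarrow>
    (\<forall>q. \<phi> q \<in> hom_set C (FObj M q) (FObj N (T \<epsilon> q))) \<and>
    (\<forall>q r. q \<le> r \<longrightarrow> Comp C (\<phi> r) (FArr M (q, r)) = Comp C (FArr N (T \<epsilon> q, T \<epsilon> r)) (\<phi> q)) \<and>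
    (\<forall>q. \<psi> q \<in> hom_set C (FObj N q) (FObj M (T \<epsilon> q))) \<and>
    (\<forall>q r. q \<le> r \<longrightarrow> Comp C (\<psi> r) (FArr N (q, r)) = Comp C (FArr M (T \<epsilon> q, T \<epsilon> r)) (\<psi> q)) \<and>
    (\<forall>q. Comp C (FArr M (T \<epsilon> (T \<epsilon> q), T (2 * \<epsilon>) q)) (Comp C (\<psi> (T \<epsilon> q)) (\<phi> q))
      = FArr M (q, T (2 * \<epsilon>) q)) \<and>
    (\<forall>q. Comp C (FArr N (T \<epsilon> (T \<epsilon> q), T (2 * \<epsilon>) q)) (Comp C (\<phi> (T \<epsilon> q)) (\<psi> q))
      = FArr N (q, T (2 * \<epsilon>) q))"
proof -
  have eta: "Comp C (eta2 T K 0 (2 * \<epsilon>) q) (eta T K 0 q) = FArr K (q, T (2 * \<epsilon>) q)"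
    if "is_module C K" for K q
    using that superlinear_family_ge[OF T] superlinear_family_zero_le[OF T] \<epsilon>
    by (simp add: eta_def eta2_def module_comp)
  show ?thesis
    by (simp add: weak_interleaving_def nat_trans_module_iff eta M N fun_eq_iff
        vcomp_def Sigma_map_def shift_hom_def shift_def conj_assoc)
qed

context category
begin

lemma weak_interleaving_iso:
  assumes iso: "module_iso C N N' \<alpha> \<beta>" and M: "is_module C M" and N: "is_module C N"
    and T: "superlinear_family T" and \<epsilon>: "0 \<le> \<epsilon>"
    and I: "weak_interleaving C T \<epsilon> M N \<phi> \<psi>"
  shows "weak_interleaving C T \<epsilon> M N'
    (\<lambda>q. Comp C (\<alpha> (T \<epsilon> q)) (\<phi> q)) (\<lambda>q. Comp C (\<psi> q) (\<beta> q))"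
proof -
  note N' = module_iso_is_module[OF iso N]
  note \<alpha> = iso_hom[OF iso N] and \<beta> = iso_inv_hom[OF iso N]
  let ?t = "T \<epsilon>" and ?s = "T (2 * \<epsilon>)"
  from I have \<phi>: "\<phi> q \<in> hom_set C (FObj M q) (FObj N (?t q))"
    and \<phi>_nat: "q \<le> r \<Longrightarrow> Comp C (\<phi> r) (FArr M (q, r)) = Comp C (FArr N (?t q, ?t r)) (\<phi> q)"
    and \<psi>: "\<psi> q \<in> hom_set C (FObj N q) (FObj M (?t q))"
    and \<psi>_nat: "q \<le> r \<Longrightarrow> Comp C (\<psi> r) (FArr N (q, r)) = Comp C (FArr M (?t q, ?t r)) (\<psi> q)"
    and M_eq: "Comp C (FArr M (?t (?t q), ?s q)) (Comp C (\<psi> (?t q)) (\<phi> q)) = FArr M (q, ?s q)"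
    and N_eq: "Comp C (FArr N (?t (?t q), ?s q)) (Comp C (\<phi> (?t q)) (\<psi> q)) = FArr N (q, ?s q)"
    for q r
    unfolding weak_interleaving_iff[OF M N T \<epsilon>] by blast+
  note mono = superlinear_family_mono[OF T \<epsilon>]
  have le: "q \<le> ?s q" and tt: "?t (?t q) \<le> ?s q" for q
    using superlinear_family_ge[OF T] superlinear_family_comp[OF T] \<epsilon> by auto
  show ?thesis
    unfolding weak_interleaving_iff[OF M N' T \<epsilon>]
  proof (intro conjI allI impI)
    fix q r
    show "Comp C (\<alpha> (?t q)) (\<phi> q) \<in> hom_set C (FObj M q) (FObj N' (?t q))"
      by (rule comp_hom[OF \<phi> \<alpha>])
    show "Comp C (\<psi> q) (\<beta> q) \<in> hom_set C (FObj N' q) (FObj M (?t q))"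
      by (rule comp_hom[OF \<beta> \<psi>])
    show "Comp C (Comp C (\<alpha> (?t r)) (\<phi> r)) (FArr M (q, r))
        = Comp C (FArr N' (?t q, ?t r)) (Comp C (\<alpha> (?t q)) (\<phi> q))" if qr: "q \<le> r"
    proof -
      note n = module_hom[OF N mono[OF qr]] and n' = module_hom[OF N' mono[OF qr]]
      have "Comp C (Comp C (\<alpha> (?t r)) (\<phi> r)) (FArr M (q, r))
          = Comp C (\<alpha> (?t r)) (Comp C (FArr N (?t q, ?t r)) (\<phi> q))"
        using comp_assoc[OF module_hom[OF M qr] \<phi> \<alpha>] \<phi>_nat[OF qr] by simp
      also have "\<dots> = Comp C (FArr N' (?t q, ?t r)) (Comp C (\<alpha> (?t q)) (\<phi> q))"
        using comp_assoc[OF \<phi> n \<alpha>] comp_assoc[OF \<phi> \<alpha> n'] iso_natural[OF iso N mono[OF qr]] by simp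
      finally show ?thesis .
    qed
    show "Comp C (Comp C (\<psi> r) (\<beta> r)) (FArr N' (q, r))
        = Comp C (FArr M (?t q, ?t r)) (Comp C (\<psi> q) (\<beta> q))" if qr: "q \<le> r"
    proof -
      note n = module_hom[OF N qr] and n' = module_hom[OF N' qr]
      have "Comp C (Comp C (\<psi> r) (\<beta> r)) (FArr N' (q, r))
          = Comp C (\<psi> r) (Comp C (FArr N (q, r)) (\<beta> q))"
        using comp_assoc[OF n' \<beta> \<psi>] iso_natural_inv[OF iso N qr] by simp
      also have "\<dots> = Comp C (FArr M (?t q, ?t r)) (Comp C (\<psi> q) (\<beta> q))"
        using comp_assoc[OF \<beta> n \<psi>] comp_assoc[OF \<beta> \<psi> module_hom[OF M mono[OF qr]]] \<psi>_nat[OF qr]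
        by simp
      finally show ?thesis .
    qed
    show "Comp C (FArr M (?t (?t q), ?s q))
        (Comp C (Comp C (\<psi> (?t q)) (\<beta> (?t q))) (Comp C (\<alpha> (?t q)) (\<phi> q))) = FArr M (q, ?s q)"
      using comp_assoc[OF comp_hom[OF \<phi> \<alpha>] \<beta> \<psi>] comp_cancel[OF \<phi> \<alpha> \<beta> iso_left[OF iso N]] M_eq
      by simp
    show "Comp C (FArr N' (?t (?t q), ?s q))
        (Comp C (Comp C (\<alpha> (?t (?t q))) (\<phi> (?t q))) (Comp C (\<psi> q) (\<beta> q))) = FArr N' (q, ?s q)"
    proof -
      note \<phi>\<psi> = comp_hom[OF \<psi> \<phi>] and n = module_hom[OF N tt] and n' = module_hom[OF N' tt]
      have "Comp C (Comp C (\<alpha> (?t (?t q))) (\<phi> (?t q))) (Comp C (\<psi> q) (\<beta> q))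
          = Comp C (\<alpha> (?t (?t q))) (Comp C (Comp C (\<phi> (?t q)) (\<psi> q)) (\<beta> q))"
        using comp_assoc[OF comp_hom[OF \<beta> \<psi>] \<phi> \<alpha>] comp_assoc[OF \<beta> \<psi> \<phi>] by simp
      then have "Comp C (FArr N' (?t (?t q), ?s q))
          (Comp C (Comp C (\<alpha> (?t (?t q))) (\<phi> (?t q))) (Comp C (\<psi> q) (\<beta> q)))
          = Comp C (Comp C (FArr N' (?t (?t q), ?s q)) (\<alpha> (?t (?t q))))
              (Comp C (Comp C (\<phi> (?t q)) (\<psi> q)) (\<beta> q))"
        using comp_assoc[OF comp_hom[OF \<beta> \<phi>\<psi>] \<alpha> n'] by simp
      also have "\<dots> = Comp C (\<alpha> (?s q))
          (Comp C (FArr N (?t (?t q), ?s q)) (Comp C (Comp C (\<phi> (?t q)) (\<psi> q)) (\<beta> q)))"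
        using comp_assoc[OF comp_hom[OF \<beta> \<phi>\<psi>] n \<alpha>] iso_natural[OF iso N tt] by simp
      also have "\<dots> = Comp C (\<alpha> (?s q)) (Comp C (FArr N (q, ?s q)) (\<beta> q))"
        using comp_assoc[OF \<beta> \<phi>\<psi> n] N_eq by simp
      finally show ?thesis
        using iso_arr[OF iso N le] by simp
    qed
  qed
qed

lemma weak_dist_iso:
  assumes iso: "module_iso C N N' \<alpha> \<beta>" and M: "is_module C M" and N: "is_module C N"
    and T: "superlinear_family T"
  shows "weak_dist C T M N' = weak_dist C T M N"
proof -
  have "(\<exists>\<phi> \<psi>. weak_interleaving C T \<epsilon> M N' \<phi> \<psi>) \<longleftrightarrow> (\<exists>\<phi> \<psi>. weak_interleaving C T \<epsilon> M N \<phi> \<psi>)"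
    if "0 \<le> \<epsilon>" for \<epsilon>
    using weak_interleaving_iso[OF iso M N T that]
      weak_interleaving_iso[OF module_iso_sym[OF iso N] M module_iso_is_module[OF iso N] T that]
    by blast
  then show ?thesis
    unfolding weak_dist_def by (metis (lifting))
qed

end

section \<open>Interleavings with pullbacks along self-maps\<close>

text \<open>The interleaving consists of internal maps only: \<open>M q \<rightarrow> M (g (T\<^sub>\<delta> q))\<close> by the lower bound on \<open>g\<close>
  and \<open>M (g q) \<rightarrow> M (T\<^sub>\<delta> q)\<close> by the upper one.\<close>

lemma (in category) weak_dist_pullback_le:
  fixes g :: "'q::order \<Rightarrow> 'q"
  assumes M: "is_module C M" and T: "superlinear_family T" and \<delta>: "0 \<le> \<delta>"
    and g: "mono g" and lower: "\<And>q. q \<le> g (T \<delta> q)" and upper: "\<And>q. g q \<le> T \<delta> q"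
  shows "weak_dist C T M (pullback g M) \<le> ereal \<delta>"
proof -
  have mono: "x \<le> y \<Longrightarrow> T \<delta> x \<le> T \<delta> y" and tt: "T \<delta> (T \<delta> x) \<le> T (2 * \<delta>) x" for x y
    using superlinear_family_mono[OF T \<delta>] superlinear_family_comp[OF T \<delta>] by blast+
  have g_mono: "x \<le> y \<Longrightarrow> g x \<le> g y" for x y
    using g by (rule monoD)
  have le: "q \<le> T (2 * \<delta>) q" for q
    using superlinear_family_ge[OF T] \<delta> by simp
  \<comment> \<open>Collapsing the round trips \<open>q, g (T q), T (T q)\<close> and \<open>g q, T q, g (T (T q))\<close> to one internal
    map requires their endpoints to be comparable.\<close>
  have M_path: "q \<le> T \<delta> (T \<delta> q)" and N_path: "g q \<le> g (T \<delta> (T \<delta> q))" for q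
    using superlinear_family_ge[OF T \<delta>] by (meson order_trans g_mono)+
  have "weak_interleaving C T \<delta> M (pullback g M)
    (\<lambda>q. FArr M (q, g (T \<delta> q))) (\<lambda>q. FArr M (g q, T \<delta> q))"
    unfolding weak_interleaving_iff[OF M is_module_pullback[OF M g] T \<delta>]
    using lower upper mono g_mono tt le M_path N_path
    by (simp add: module_hom[OF M] module_comp[OF M])
  then show ?thesis
    unfolding weak_dist_def using \<delta> by (intro Inf_lower) blast
qed

section \<open>Pushforward along a left adjoint\<close>

text \<open>The cocone of internal maps into \<open>D m\<close> is universal: a map \<open>h\<close> out of \<open>D m\<close> under \<open>D\<close> is
  determined by its composite with the identity \<open>D m \<rightarrow> D m\<close>.\<close>

lemma (in category) is_colimit_greatest:
  assumes D: "is_module C D" and m: "m \<in> S" "\<And>x. x \<in> S \<Longrightarrow> x \<le> m"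
  shows "is_colimit (poset_cat S) C D (FObj D m) (\<lambda>x. FArr D (x, m))"
  unfolding is_colimit_def
proof (intro conjI allI impI)
  show "is_cocone (poset_cat S) C D (FObj D m) (\<lambda>x. FArr D (x, m))"
    using m by (auto simp: is_cocone_def hom_set_poset_cat module_obj[OF D] module_hom[OF D]
        module_comp[OF D])
  fix c \<kappa>
  assume K: "is_cocone (poset_cat S) C D c \<kappa>"
  show "\<exists>!h. h \<in> hom_set C (FObj D m) c \<and>
      (\<forall>x \<in> Obj (poset_cat S). Comp C h (FArr D (x, m)) = \<kappa> x)"
  proof (rule ex1I[of _ "\<kappa> m"])
    show "\<kappa> m \<in> hom_set C (FObj D m) c \<and>
        (\<forall>x \<in> Obj (poset_cat S). Comp C (\<kappa> m) (FArr D (x, m)) = \<kappa> x)"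
      using K m by (auto simp: is_cocone_def hom_set_poset_cat)
    show "h = \<kappa> m" if "h \<in> hom_set C (FObj D m) c \<and>
        (\<forall>x \<in> Obj (poset_cat S). Comp C h (FArr D (x, m)) = \<kappa> x)" for h
      using that m by (auto simp: module_id[OF D] comp_id_right)
  qed
qed

text \<open>A pushforward is built from an arbitrary choice of colimits. The universal property of the
  chosen one supplies the map \<open>b\<close> to \<open>D m\<close> that makes the component \<open>\<iota> m\<close> invertible.\<close>

lemma (in category) colimit_greatest_inverse:
  assumes D: "is_module C D" and m: "m \<in> S" "\<And>x. x \<in> S \<Longrightarrow> x \<le> m"
    and K: "is_colimit (poset_cat S) C D c \<iota>"
  obtains b where "b \<in> hom_set C c (FObj D m)" "\<And>x. x \<in> S \<Longrightarrow> Comp C b (\<iota> x) = FArr D (x, m)"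
    "Comp C (\<iota> m) b = Id C c"
proof -
  have cocone: "is_cocone (poset_cat S) C D c \<iota>"
    using K by (simp add: is_colimit_def)
  then have \<iota>: "x \<in> S \<Longrightarrow> \<iota> x \<in> hom_set C (FObj D x) c"
    and \<iota>_arr: "x \<in> S \<Longrightarrow> Comp C (\<iota> m) (FArr D (x, m)) = \<iota> x" for x
    using m by (auto simp: is_cocone_def hom_set_poset_cat)
  have "is_cocone (poset_cat S) C D (FObj D m) (\<lambda>x. FArr D (x, m))"
    using is_colimit_greatest[OF D m] by (simp add: is_colimit_def)
  then obtain b where b: "b \<in> hom_set C c (FObj D m)"
    and b_arr: "\<And>x. x \<in> S \<Longrightarrow> Comp C b (\<iota> x) = FArr D (x, m)"
    using K unfolding is_colimit_def by (metis poset_cat_simps(1))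
  \<comment> \<open>Both sides are endomorphisms of the colimit that fix the colimiting cocone.\<close>
  have "Comp C (\<iota> m) b = Id C c"
  proof -
    have "\<exists>!h. h \<in> hom_set C c c \<and> (\<forall>x \<in> S. Comp C h (\<iota> x) = \<iota> x)"
      using K cocone unfolding is_colimit_def by simp
    moreover have "Comp C (\<iota> m) b \<in> hom_set C c c"
      by (rule comp_hom[OF b \<iota>[OF m(1)]])
    moreover have "\<forall>x \<in> S. Comp C (Comp C (\<iota> m) b) (\<iota> x) = \<iota> x"
      using comp_assoc[OF \<iota> b \<iota>[OF m(1)]] b_arr \<iota>_arr by simp
    moreover have "Id C c \<in> hom_set C c c"
      using cocone id_hom by (simp add: is_cocone_def)
    moreover have "\<forall>x \<in> S. Comp C (Id C c) (\<iota> x) = \<iota> x"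
      using comp_id_left[OF \<iota>] by blast
    ultimately show ?thesis by blast
  qed
  with that b b_arr show thesis by blast
qed

text \<open>The adjunction says that \<open>g q\<close> is the greatest element of \<open>{p. f p \<le> q}\<close>. The components of the
  isomorphism are the legs of the chosen colimiting cocones at these greatest elements.\<close>

lemma (in category) pushforward_iso_pullback:
  fixes f :: "'p::order \<Rightarrow> 'q::order"
  assumes N: "is_module C N" and adj: "\<And>p q. f p \<le> q \<longleftrightarrow> p \<le> g q"
  obtains \<alpha> \<beta> where "module_iso C (pullback g N) (pushforward C f N) \<alpha> \<beta>"
proof -
  define K where "K q = colimit_cocone (poset_cat {p. f p \<le> q}) C N" for q
  define c where "c q = fst (K q)" for q
  define \<iota> where "\<iota> q = snd (K q)" for q
  have colim: "is_colimit (poset_cat {p. f p \<le> q}) C N (c q) (\<iota> q)" for q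
  proof -
    have "is_colimit (poset_cat {p. f p \<le> q}) C N (FObj N (g q)) (\<lambda>p. FArr N (p, g q))"
      by (rule is_colimit_greatest[OF N]) (auto simp: adj)
    then have "case K q of (c, \<iota>) \<Rightarrow> is_colimit (poset_cat {p. f p \<le> q}) C N c \<iota>"
      unfolding K_def colimit_cocone_def by (intro someI) auto
    then show ?thesis
      by (simp add: c_def \<iota>_def case_prod_beta)
  qed
  have \<iota>: "p \<le> g q \<Longrightarrow> \<iota> q p \<in> hom_set C (FObj N p) (c q)"
    and \<iota>_arr: "p \<le> p' \<Longrightarrow> p' \<le> g q \<Longrightarrow> Comp C (\<iota> q p') (FArr N (p, p')) = \<iota> q p" for p p' q
    using colim[of q] order_trans[of p p' "g q"]
    by (auto simp: is_colimit_def is_cocone_def hom_set_poset_cat adj)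
  have "\<exists>b. b \<in> hom_set C (c q) (FObj N (g q)) \<and>
      (\<forall>p. p \<le> g q \<longrightarrow> Comp C b (\<iota> q p) = FArr N (p, g q)) \<and> Comp C (\<iota> q (g q)) b = Id C (c q)" for q
    by (rule colimit_greatest_inverse[OF N _ _ colim[of q], of "g q"]) (auto simp: adj)
  then obtain \<beta> where \<beta>: "\<beta> q \<in> hom_set C (c q) (FObj N (g q))"
    and \<beta>_arr: "p \<le> g q \<Longrightarrow> Comp C (\<beta> q) (\<iota> q p) = FArr N (p, g q)"
    and \<beta>_right: "Comp C (\<iota> q (g q)) (\<beta> q) = Id C (c q)" for p q
    by metis
  let ?P = "pushforward C f N"
  have arr: "FArr ?P (q, r) = Comp C (\<iota> r (g r)) (Comp C (FArr N (g q, g r)) (\<beta> q))"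
    if qr: "q \<le> r" for q r
  proof -
    have gqr: "g q \<le> g r"
      using adj[of "g q" q] adj[of "g q" r] qr by (auto intro: order_trans)
    note n = module_hom[OF N gqr] and \<iota>q = \<iota>[of "g q" q, OF order_refl]
      and \<iota>r = \<iota>[of "g r" r, OF order_refl]
    let ?k = "Comp C (\<iota> r (g r)) (Comp C (FArr N (g q, g r)) (\<beta> q))"
    have "FArr ?P (q, r)
        = (THE h. h \<in> hom_set C (c q) (c r) \<and> (\<forall>p. f p \<le> q \<longrightarrow> Comp C h (\<iota> q p) = \<iota> r p))"
      by (simp add: pushforward_def c_def \<iota>_def K_def)
    also have "\<dots> = ?k"
    proof (rule the_equality, intro conjI allI impI)
      show "?k \<in> hom_set C (c q) (c r)"
        by (rule comp_hom[OF comp_hom[OF \<beta> n] \<iota>r])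
      fix p assume "f p \<le> q"
      then have p: "p \<le> g q" by (simp add: adj)
      have "Comp C ?k (\<iota> q p) = Comp C (\<iota> r (g r)) (Comp C (FArr N (g q, g r)) (FArr N (p, g q)))"
        using comp_assoc[OF \<iota>[OF p] comp_hom[OF \<beta> n] \<iota>r] comp_assoc[OF \<iota>[OF p] \<beta> n] \<beta>_arr[OF p]
        by simp
      also have "\<dots> = \<iota> r p"
        using module_comp[OF N p gqr] \<iota>_arr[of p "g r" r] p gqr by simp
      finally show "Comp C ?k (\<iota> q p) = \<iota> r p" .
    next
      fix h assume h: "h \<in> hom_set C (c q) (c r) \<and> (\<forall>p. f p \<le> q \<longrightarrow> Comp C h (\<iota> q p) = \<iota> r p)"
      then have "Comp C h (\<iota> q (g q)) = Comp C (\<iota> r (g r)) (FArr N (g q, g r))"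
        using \<iota>_arr[OF gqr] by (simp add: adj)
      moreover have "h = Comp C (Comp C h (\<iota> q (g q))) (\<beta> q)"
        using h comp_assoc[OF \<beta> \<iota>q] comp_id_right \<beta>_right by metis
      ultimately show "h = ?k"
        using comp_assoc[OF \<beta> n \<iota>r] by simp
    qed
    finally show ?thesis .
  qed
  have obj: "FObj ?P q = c q" for q
    by (simp add: pushforward_def c_def K_def)
  have "module_iso C (pullback g N) ?P (\<lambda>q. \<iota> q (g q)) \<beta>"
    by (simp add: module_iso_def obj arr \<iota> \<beta> \<beta>_arr \<beta>_right module_id[OF N])
  with that show thesis .
qed

section \<open>Pushforward with open supports along a right adjoint\<close>

lemma (in category) is_limit_least:
  assumes D: "is_module C D" and m: "m \<in> S" "\<And>x. x \<in> S \<Longrightarrow> m \<le> x"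
  shows "is_limit (poset_cat S) C D (FObj D m) (\<lambda>x. FArr D (m, x))"
  unfolding is_limit_def
proof (intro conjI allI impI)
  show "is_cone (poset_cat S) C D (FObj D m) (\<lambda>x. FArr D (m, x))"
    using m by (auto simp: is_cone_def hom_set_poset_cat module_obj[OF D] module_hom[OF D]
        module_comp[OF D])
  fix c \<kappa>
  assume K: "is_cone (poset_cat S) C D c \<kappa>"
  show "\<exists>!h. h \<in> hom_set C c (FObj D m) \<and>
      (\<forall>x \<in> Obj (poset_cat S). Comp C (FArr D (m, x)) h = \<kappa> x)"
  proof (rule ex1I[of _ "\<kappa> m"])
    show "\<kappa> m \<in> hom_set C c (FObj D m) \<and>
        (\<forall>x \<in> Obj (poset_cat S). Comp C (FArr D (m, x)) (\<kappa> m) = \<kappa> x)"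
      using K m by (auto simp: is_cone_def hom_set_poset_cat)
    show "h = \<kappa> m" if "h \<in> hom_set C c (FObj D m) \<and>
        (\<forall>x \<in> Obj (poset_cat S). Comp C (FArr D (m, x)) h = \<kappa> x)" for h
      using that m by (auto simp: module_id[OF D] comp_id_left)
  qed
qed

lemma (in category) limit_least_inverse:
  assumes D: "is_module C D" and m: "m \<in> S" "\<And>x. x \<in> S \<Longrightarrow> m \<le> x"
    and K: "is_limit (poset_cat S) C D c \<pi>"
  obtains a where "a \<in> hom_set C (FObj D m) c" "\<And>x. x \<in> S \<Longrightarrow> Comp C (\<pi> x) a = FArr D (m, x)"
    "Comp C a (\<pi> m) = Id C c"
proof -
  have cone: "is_cone (poset_cat S) C D c \<pi>"
    using K by (simp add: is_limit_def)
  then have \<pi>: "x \<in> S \<Longrightarrow> \<pi> x \<in> hom_set C c (FObj D x)"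
    and \<pi>_arr: "x \<in> S \<Longrightarrow> Comp C (FArr D (m, x)) (\<pi> m) = \<pi> x" for x
    using m by (auto simp: is_cone_def hom_set_poset_cat)
  have "is_cone (poset_cat S) C D (FObj D m) (\<lambda>x. FArr D (m, x))"
    using is_limit_least[OF D m] by (simp add: is_limit_def)
  then obtain a where a: "a \<in> hom_set C (FObj D m) c"
    and a_arr: "\<And>x. x \<in> S \<Longrightarrow> Comp C (\<pi> x) a = FArr D (m, x)"
    using K unfolding is_limit_def by (metis poset_cat_simps(1))
  \<comment> \<open>Both sides are endomorphisms of the limit that fix the limiting cone.\<close>
  have "Comp C a (\<pi> m) = Id C c"
  proof -
    have "\<exists>!h. h \<in> hom_set C c c \<and> (\<forall>x \<in> S. Comp C (\<pi> x) h = \<pi> x)"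
      using K cone unfolding is_limit_def by simp
    moreover have "Comp C a (\<pi> m) \<in> hom_set C c c"
      by (rule comp_hom[OF \<pi>[OF m(1)] a])
    moreover have "\<forall>x \<in> S. Comp C (\<pi> x) (Comp C a (\<pi> m)) = \<pi> x"
      using comp_assoc[OF \<pi>[OF m(1)] a \<pi>] a_arr \<pi>_arr by simp
    moreover have "Id C c \<in> hom_set C c c"
      using cone id_hom by (simp add: is_cone_def)
    moreover have "\<forall>x \<in> S. Comp C (\<pi> x) (Id C c) = \<pi> x"
      using comp_id_right[OF \<pi>] by blast
    ultimately show ?thesis by blast
  qed
  with that a a_arr show thesis by blast
qed

text \<open>Dually, \<open>g q\<close> is the least element of \<open>{p. q \<le> f p}\<close>, and the inverse of the isomorphism consists
  of the legs of the chosen limiting cones at these least elements.\<close>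

lemma (in category) pushforward_open_iso_pullback:
  fixes f :: "'p::order \<Rightarrow> 'q::order"
  assumes N: "is_module C N" and adj: "\<And>p q. q \<le> f p \<longleftrightarrow> g q \<le> p"
  obtains \<alpha> \<beta> where "module_iso C (pullback g N) (pushforward_open C f N) \<alpha> \<beta>"
proof -
  define K where "K q = limit_cone (poset_cat {p. q \<le> f p}) C N" for q
  define c where "c q = fst (K q)" for q
  define \<pi> where "\<pi> q = snd (K q)" for q
  have lim: "is_limit (poset_cat {p. q \<le> f p}) C N (c q) (\<pi> q)" for q
  proof -
    have "is_limit (poset_cat {p. q \<le> f p}) C N (FObj N (g q)) (\<lambda>p. FArr N (g q, p))"
      by (rule is_limit_least[OF N]) (auto simp: adj)
    then have "case K q of (c, \<pi>) \<Rightarrow> is_limit (poset_cat {p. q \<le> f p}) C N c \<pi>"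
      unfolding K_def limit_cone_def by (intro someI) auto
    then show ?thesis
      by (simp add: c_def \<pi>_def case_prod_beta)
  qed
  have \<pi>: "g q \<le> p \<Longrightarrow> \<pi> q p \<in> hom_set C (c q) (FObj N p)"
    and \<pi>_arr: "p \<le> p' \<Longrightarrow> g q \<le> p \<Longrightarrow> Comp C (FArr N (p, p')) (\<pi> q p) = \<pi> q p'" for p p' q
    using lim[of q] order_trans[of "g q" p p']
    by (auto simp: is_limit_def is_cone_def hom_set_poset_cat adj)
  have "\<exists>a. a \<in> hom_set C (FObj N (g q)) (c q) \<and>
      (\<forall>p. g q \<le> p \<longrightarrow> Comp C (\<pi> q p) a = FArr N (g q, p)) \<and> Comp C a (\<pi> q (g q)) = Id C (c q)" for q
    by (rule limit_least_inverse[OF N _ _ lim[of q], of "g q"]) (auto simp: adj)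
  then obtain \<alpha> where \<alpha>: "\<alpha> q \<in> hom_set C (FObj N (g q)) (c q)"
    and \<alpha>_arr: "g q \<le> p \<Longrightarrow> Comp C (\<pi> q p) (\<alpha> q) = FArr N (g q, p)"
    and \<alpha>_right: "Comp C (\<alpha> q) (\<pi> q (g q)) = Id C (c q)" for p q
    by metis
  let ?P = "pushforward_open C f N"
  have arr: "FArr ?P (q, r) = Comp C (\<alpha> r) (Comp C (FArr N (g q, g r)) (\<pi> q (g q)))"
    if qr: "q \<le> r" for q r
  proof -
    have gqr: "g q \<le> g r"
      using adj[of q "g r"] adj[of r "g r"] qr by (auto intro: order_trans)
    note n = module_hom[OF N gqr] and \<pi>q = \<pi>[of q "g q", OF order_refl]
      and \<pi>r = \<pi>[of r "g r", OF order_refl]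
    let ?k = "Comp C (\<alpha> r) (Comp C (FArr N (g q, g r)) (\<pi> q (g q)))"
    have "FArr ?P (q, r)
        = (THE h. h \<in> hom_set C (c q) (c r) \<and> (\<forall>p. r \<le> f p \<longrightarrow> Comp C (\<pi> r p) h = \<pi> q p))"
      by (simp add: pushforward_open_def c_def \<pi>_def K_def)
    also have "\<dots> = ?k"
    proof (rule the_equality, intro conjI allI impI)
      show "?k \<in> hom_set C (c q) (c r)"
        by (rule comp_hom[OF comp_hom[OF \<pi>q n] \<alpha>])
      fix p assume "r \<le> f p"
      then have p: "g r \<le> p" by (simp add: adj)
      have "Comp C (\<pi> r p) ?k = Comp C (FArr N (g r, p)) (Comp C (FArr N (g q, g r)) (\<pi> q (g q)))"
        using comp_assoc[OF comp_hom[OF \<pi>q n] \<alpha> \<pi>[OF p]] \<alpha>_arr[OF p] by simp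
      also have "\<dots> = \<pi> q p"
        using \<pi>_arr[of "g q" "g r" q] \<pi>_arr[of "g r" p q] p gqr by simp
      finally show "Comp C (\<pi> r p) ?k = \<pi> q p" .
    next
      fix h assume h: "h \<in> hom_set C (c q) (c r) \<and> (\<forall>p. r \<le> f p \<longrightarrow> Comp C (\<pi> r p) h = \<pi> q p)"
      then have "Comp C (\<pi> r (g r)) h = Comp C (FArr N (g q, g r)) (\<pi> q (g q))"
        using \<pi>_arr[OF gqr] by (simp add: adj)
      moreover have "Comp C (\<alpha> r) (Comp C (\<pi> r (g r)) h) = h"
        using h comp_cancel[OF _ \<pi>r \<alpha> \<alpha>_right] by blast
      ultimately show "h = ?k" by simp
    qed
    finally show ?thesis .
  qed
  have obj: "FObj ?P q = c q" for q
    by (simp add: pushforward_open_def c_def K_def)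
  have "module_iso C (pullback g N) ?P \<alpha> (\<lambda>q. \<pi> q (g q))"
    by (simp add: module_iso_def obj arr \<pi> \<alpha> \<alpha>_arr \<alpha>_right module_id[OF N])
  with that show thesis .
qed

section \<open>Pixelizations\<close>

lemma respects_joins_adjoint:
  assumes f: "mono f" "respects_joins f"
  shows "f x \<le> q \<longleftrightarrow> x \<le> flat f q"
proof
  show "x \<le> flat f q" if "f x \<le> q"
    using that by (simp add: flat_def Sup_upper)
  have "f (flat f q) \<le> q"
    using f(2) by (simp add: respects_joins_def flat_def)
  then show "f x \<le> q" if "x \<le> flat f q"
    using monoD[OF f(1) that] by (rule order_trans[rotated])
qed

lemma respects_meets_adjoint:
  assumes f: "mono f" "respects_meets f"
  shows "q \<le> f x \<longleftrightarrow> sharp f q \<le> x"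
proof
  show "sharp f q \<le> x" if "q \<le> f x"
    using that by (simp add: sharp_def Inf_lower)
  have "q \<le> f (sharp f q)"
    using f(2) by (simp add: respects_meets_def sharp_def)
  then show "q \<le> f x" if "sharp f q \<le> x"
    using monoD[OF f(1) that] by (rule order_trans)
qed

lemma mono_flat: "mono (flat f)"
  unfolding flat_def by (intro monoI Sup_subset_mono) (auto intro: order_trans)

lemma mono_sharp: "mono (sharp f)"
  unfolding sharp_def by (intro monoI Inf_superset_mono) (auto intro: order_trans)

lemma (in category) lower_pixelization_dist:
  fixes f :: "'l::complete_lattice \<Rightarrow> 'q::order"
  assumes M: "is_module C M" and T: "superlinear_family T" and \<delta>: "0 \<le> \<delta>"
    and f: "mono f" "respects_joins f" and approx: "is_approximation T \<delta> f"
  shows "weak_dist C T M (pushforward C f (pullback f M)) = weak_dist C T M (pullback (f \<circ> flat f) M)"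
    and "weak_dist C T M (pullback (f \<circ> flat f) M) \<le> ereal \<delta>"
proof -
  note adj = respects_joins_adjoint[OF f]
  have g: "mono (f \<circ> flat f)"
    using f(1) mono_flat[of f] by (simp add: mono_def)
  obtain \<alpha> \<beta> where "module_iso C (pullback (flat f) (pullback f M))
      (pushforward C f (pullback f M)) \<alpha> \<beta>"
    using pushforward_iso_pullback[OF is_module_pullback[OF M f(1)] adj] .
  then show "weak_dist C T M (pushforward C f (pullback f M))
      = weak_dist C T M (pullback (f \<circ> flat f) M)"
    unfolding pullback_pullback by (rule weak_dist_iso[OF _ M is_module_pullback[OF M g] T])
  show "weak_dist C T M (pullback (f \<circ> flat f) M) \<le> ereal \<delta>"
  proof (rule weak_dist_pullback_le[OF M T \<delta> g])
    fix q
    obtain x where x: "q \<le> f x" "f x \<le> T \<delta> q"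
      using approx unfolding is_approximation_def by blast
    then have "f x \<le> f (flat f (T \<delta> q))"
      using monoD[OF f(1)] adj by blast
    with x show "q \<le> (f \<circ> flat f) (T \<delta> q)" by simp
    have "f (flat f q) \<le> q" by (simp add: adj)
    with superlinear_family_ge[OF T \<delta>] show "(f \<circ> flat f) q \<le> T \<delta> q"
      by (metis comp_apply order_trans)
  qed
qed

lemma (in category) upper_pixelization_dist:
  fixes f :: "'l::complete_lattice \<Rightarrow> 'q::order"
  assumes M: "is_module C M" and T: "superlinear_family T" and \<delta>: "0 \<le> \<delta>"
    and f: "mono f" "respects_meets f" and approx: "is_approximation T \<delta> f"
  shows "weak_dist C T M (pushforward_open C f (pullback f M))
      = weak_dist C T M (pullback (f \<circ> sharp f) M)"
    and "weak_dist C T M (pullback (f \<circ> sharp f) M) \<le> ereal \<delta>"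
proof -
  note adj = respects_meets_adjoint[OF f]
  have g: "mono (f \<circ> sharp f)"
    using f(1) mono_sharp[of f] by (simp add: mono_def)
  obtain \<alpha> \<beta> where "module_iso C (pullback (sharp f) (pullback f M))
      (pushforward_open C f (pullback f M)) \<alpha> \<beta>"
    using pushforward_open_iso_pullback[OF is_module_pullback[OF M f(1)] adj] .
  then show "weak_dist C T M (pushforward_open C f (pullback f M))
      = weak_dist C T M (pullback (f \<circ> sharp f) M)"
    unfolding pullback_pullback by (rule weak_dist_iso[OF _ M is_module_pullback[OF M g] T])
  show "weak_dist C T M (pullback (f \<circ> sharp f) M) \<le> ereal \<delta>"
  proof (rule weak_dist_pullback_le[OF M T \<delta> g])
    fix q
    have *: "r \<le> f (sharp f r)" for r by (simp add: adj)
    with superlinear_family_ge[OF T \<delta>] show "q \<le> (f \<circ> sharp f) (T \<delta> q)"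
      by (metis comp_apply order_trans)
    obtain x where x: "q \<le> f x" "f x \<le> T \<delta> q"
      using approx unfolding is_approximation_def by blast
    then have "f (sharp f q) \<le> f x"
      using monoD[OF f(1)] adj by blast
    with x show "(f \<circ> sharp f) q \<le> T \<delta> q" by simp
  qed
qed


theorem theorem5p13:
  fixes f :: "'l::complete_lattice \<Rightarrow> 'q::order"
    and T :: "real \<Rightarrow> 'q \<Rightarrow> 'q"
    and \<delta> :: real
    and C :: "('o, 'a) cat"
    and i :: "'l \<Rightarrow> 'u"
  assumes "infinite (UNIV :: 'u set)" and "inj i"
    and "category C"
    and "has_small_limits TYPE('u) C" and "has_small_colimits TYPE('u) C"
    and "superlinear_family T"
    and "mono f"
    and "0 \<le> \<delta>"
  shows
    "(is_approximation T \<delta> f \<and> respects_joins f \<longrightarrow>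
      (\<forall>M. is_module C M \<longrightarrow>
        weak_dist C T M (pushforward C f (pullback f M)) =
          weak_dist C T M (pullback (f \<circ> flat f) M) \<and>
        weak_dist C T M (pullback (f \<circ> flat f) M) \<le> ereal \<delta>)) \<and>
     (is_approximation T \<delta> f \<and> respects_meets f \<longrightarrow>
      (\<forall>M. is_module C M \<longrightarrow>
        weak_dist C T M (pushforward_open C f (pullback f M)) =
          weak_dist C T M (pullback (f \<circ> sharp f) M) \<and>
        weak_dist C T M (pullback (f \<circ> sharp f) M) \<le> ereal \<delta>))"
proof (intro conjI impI allI; elim conjE)
  interpret category C by fact
  fix M :: "('q, 'o, 'a) pmodule"
  assume M: "is_module C M" and approx: "is_approximation T \<delta> f"
  show "weak_dist C T M (pushforward C f (pullback f M)) = weak_dist C T M (pullback (f \<circ> flat f) M)"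
    "weak_dist C T M (pullback (f \<circ> flat f) M) \<le> ereal \<delta>" if "respects_joins f"
    using lower_pixelization_dist[OF M assms(6,8,7) that approx] .
  show "weak_dist C T M (pushforward_open C f (pullback f M))
      = weak_dist C T M (pullback (f \<circ> sharp f) M)"
    "weak_dist C T M (pullback (f \<circ> sharp f) M) \<le> ereal \<delta>" if "respects_meets f"
    using upper_pixelization_dist[OF M assms(6,8,7) that approx] .
qed

end
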